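(* Let $G$ be an $n\times n$ grid with $n$ even. Every initial configuration of $k\ge3$ robots on distinct nodes of $G$ in which exactly two corners of the minimum enclosing square are occupied, which is non-partitive and is not a 2S2 configuration, is gatherable despite at most one crash fault.
   Context: Model. The grid is the anonymous grid graph. A configuration is $f:V(G)\to\{0,1,2\}$ ($0$ empty, $1$ singleton, $2$ multiplicity). Robots are anonymous, identical, oblivious, cannot communicate, share no coordinate system, orientation or chirality, run the same deterministic algorithm in Look–Compute–Move cycles (snapshot of the whole configuration with weak multiplicity detection; decision; instantaneous move to an adjacent node or stay), fully asynchronously (finite but unbounded adversarial delays; every non-crashed robot activated infinitely often). At most one robot may crash at an adversarial time (stops forever, stays visible, indistinguishable). Gatherable despite at most one crash fault: some such algorithm guarantees in every execution with at most one crash that after finite time all non-crashed robots are on one node and remain there. Partitive: some automorphism $\varphi$ of $(G,f)$ of order $p>1$ has all orbits of $V(G)$ under $\langle\varphi\rangle$ of size exactly $p$. Minimum enclosing square (MES): smallest square subgrid with the same geometric center as the grid containing all occupied nodes; its corners are its four corner nodes. 2S2: exactly two MES corners are occupied, they are diagonally opposite, and the configuration is invariant under reflection in the MES diagonal through the two unoccupied corners. *)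

theory Defs
  imports Main
begin

type_synonym node = "nat \<times> nat"

definition grid_nodes :: "nat \<Rightarrow> node set" where
  "grid_nodes n = {(i, j). i < n \<and> j < n}"

definition grid_adj :: "node \<Rightarrow> node \<Rightarrow> bool" where
  "grid_adj u v \<longleftrightarrow>
     (fst u = fst v \<and> (snd u = snd v + 1 \<or> snd v = snd u + 1)) \<or>
     (snd u = snd v \<and> (fst u = fst v + 1 \<or> fst v = fst u + 1))"

definition grid_aut :: "nat \<Rightarrow> (node \<Rightarrow> node) \<Rightarrow> bool" where
  "grid_aut n \<sigma> \<longleftrightarrow> bij_betw \<sigma> (grid_nodes n) (grid_nodes n) \<and>
     (\<forall>u \<in> grid_nodes n. \<forall>v \<in> grid_nodes n. grid_adj u v \<longleftrightarrow> grid_adj (\<sigma> u) (\<sigma> v))"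

text \<open>Configuration f : V -> {0,1,2} (0 empty, 1 singleton, 2 multiplicity) induced by
  the positions of robots 0..k-1 (weak multiplicity detection).\<close>
definition conf :: "nat \<Rightarrow> (nat \<Rightarrow> node) \<Rightarrow> node \<Rightarrow> nat" where
  "conf k P v = (let c = card {r. r < k \<and> P r = v} in if c = 0 then 0 else if c = 1 then 1 else 2)"

definition conf_aut :: "nat \<Rightarrow> (node \<Rightarrow> nat) \<Rightarrow> (node \<Rightarrow> node) \<Rightarrow> bool" where
  "conf_aut n f \<phi> \<longleftrightarrow> grid_aut n \<phi> \<and> (\<forall>v \<in> grid_nodes n. f (\<phi> v) = f v)"

definition partitive :: "nat \<Rightarrow> (node \<Rightarrow> nat) \<Rightarrow> bool" where
  "partitive n f \<longleftrightarrow> (\<exists>\<phi> p. conf_aut n f \<phi> \<and> p > 1 \<and>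
      (\<forall>v \<in> grid_nodes n. (\<phi> ^^ p) v = v) \<and>
      (\<forall>q. 0 < q \<and> q < p \<longrightarrow> \<not> (\<forall>v \<in> grid_nodes n. (\<phi> ^^ q) v = v)) \<and>
      (\<forall>v \<in> grid_nodes n. card {(\<phi> ^^ i) v | i. True} = p))"

definition in_sq :: "nat \<Rightarrow> nat \<Rightarrow> node \<Rightarrow> bool" where
  "in_sq n m v \<longleftrightarrow> m \<le> fst v \<and> fst v + m < n \<and> m \<le> snd v \<and> snd v + m < n"

text \<open>Offset of the minimum enclosing square (MES): largest offset (i.e. smallest concentric square)
  containing every occupied node.\<close>
definition mes :: "nat \<Rightarrow> (node \<Rightarrow> nat) \<Rightarrow> nat" where
  "mes n f = (GREATEST m. 2 * m < n \<and> (\<forall>v \<in> grid_nodes n. f v \<noteq> 0 \<longrightarrow> in_sq n m v))"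

definition mes_c1 :: "nat \<Rightarrow> (node \<Rightarrow> nat) \<Rightarrow> node" where
  "mes_c1 n f = (mes n f, mes n f)"
definition mes_c2 :: "nat \<Rightarrow> (node \<Rightarrow> nat) \<Rightarrow> node" where
  "mes_c2 n f = (mes n f, n - 1 - mes n f)"
definition mes_c3 :: "nat \<Rightarrow> (node \<Rightarrow> nat) \<Rightarrow> node" where
  "mes_c3 n f = (n - 1 - mes n f, n - 1 - mes n f)"
definition mes_c4 :: "nat \<Rightarrow> (node \<Rightarrow> nat) \<Rightarrow> node" where
  "mes_c4 n f = (n - 1 - mes n f, mes n f)"

definition mes_corners :: "nat \<Rightarrow> (node \<Rightarrow> nat) \<Rightarrow> node set" where
  "mes_corners n f = {mes_c1 n f, mes_c2 n f, mes_c3 n f, mes_c4 n f}"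

definition two_corners_occupied :: "nat \<Rightarrow> (node \<Rightarrow> nat) \<Rightarrow> bool" where
  "two_corners_occupied n f \<longleftrightarrow> card {c \<in> mes_corners n f. f c \<noteq> 0} = 2"

definition refl_main :: "node \<Rightarrow> node" where
  "refl_main v = (snd v, fst v)"
definition refl_anti :: "nat \<Rightarrow> node \<Rightarrow> node" where
  "refl_anti n v = (n - 1 - snd v, n - 1 - fst v)"

definition is_2S2 :: "nat \<Rightarrow> (node \<Rightarrow> nat) \<Rightarrow> bool" where
  "is_2S2 n f \<longleftrightarrow> two_corners_occupied n f \<and>
     ((f (mes_c1 n f) \<noteq> 0 \<and> f (mes_c3 n f) \<noteq> 0 \<and>
        (\<forall>v \<in> grid_nodes n. f (refl_anti n v) = f v)) \<or>
      (f (mes_c2 n f) \<noteq> 0 \<and> f (mes_c4 n f) \<noteq> 0 \<and>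
        (\<forall>v \<in> grid_nodes n. f (refl_main v) = f v)))"

text \<open>An algorithm maps (snapshot in the robot's own frame, own position in that frame) to a
  destination, which must be the own node or an adjacent node.\<close>
type_synonym algo = "(node \<Rightarrow> nat) \<Rightarrow> node \<Rightarrow> node"

definition valid_algo :: "nat \<Rightarrow> algo \<Rightarrow> bool" where
  "valid_algo n A \<longleftrightarrow> (\<forall>g. \<forall>u \<in> grid_nodes n. A g u = u \<or> grid_adj u (A g u))"

text \<open>The snapshot f as seen in a local frame \<sigma> (an arbitrary grid automorphism, chosen
  adversarially at each Look): no common coordinates, orientation or chirality.\<close>
definition view :: "nat \<Rightarrow> (node \<Rightarrow> node) \<Rightarrow> (node \<Rightarrow> nat) \<Rightarrow> node \<Rightarrow> nat" where
  "view n \<sigma> f u = (if u \<in> grid_nodes n then f (\<sigma> u) else 0)"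

text \<open>Asynchronous LCM executions (interleaving of atomic Look+Compute and Move events).
  P t r: position of robot r at time t; Q t r: pending destination (Some d after a Look,
  None when idle); act t: the robot acting at step t.\<close>
definition execution :: "nat \<Rightarrow> nat \<Rightarrow> algo \<Rightarrow> (nat \<Rightarrow> node) \<Rightarrow>
    (nat \<Rightarrow> nat \<Rightarrow> node) \<Rightarrow> (nat \<Rightarrow> nat \<Rightarrow> node option) \<Rightarrow> (nat \<Rightarrow> nat) \<Rightarrow> bool" where
  "execution n k A P0 P Q act \<longleftrightarrow>
     P 0 = P0 \<and> Q 0 = (\<lambda>_. None) \<and>
     (\<forall>t. act t < k \<and>
        (let r = act t in
          (Q t r = None \<longrightarrow>
             P (Suc t) = P t \<and>
             (\<exists>\<sigma>. grid_aut n \<sigma> \<and>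
                Q (Suc t) = (Q t)(r := Some (\<sigma> (A (view n \<sigma> (conf k (P t)))
                                                  (inv_into (grid_nodes n) \<sigma> (P t r))))))) \<and>
          (\<forall>d. Q t r = Some d \<longrightarrow>
             P (Suc t) = (P t)(r := d) \<and> Q (Suc t) = (Q t)(r := None))))"

text \<open>At most one crash: all robots but at most one are activated infinitely often; a robot
  activated only finitely often is the crashed one (it stops forever and stays visible).\<close>
definition at_most_one_crash :: "nat \<Rightarrow> (nat \<Rightarrow> nat) \<Rightarrow> bool" where
  "at_most_one_crash k act \<longleftrightarrow> card {r. r < k \<and> finite {t. act t = r}} \<le> 1"

definition gathered :: "nat \<Rightarrow> (nat \<Rightarrow> nat \<Rightarrow> node) \<Rightarrow> (nat \<Rightarrow> nat) \<Rightarrow> bool" where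
  "gathered k P act \<longleftrightarrow> (\<exists>T v. \<forall>t \<ge> T. \<forall>r < k. infinite {s. act s = r} \<longrightarrow> P t r = v)"

definition gatherable_one_crash :: "nat \<Rightarrow> nat \<Rightarrow> (nat \<Rightarrow> node) \<Rightarrow> bool" where
  "gatherable_one_crash n k P0 \<longleftrightarrow>
     (\<exists>A. valid_algo n A \<and>
        (\<forall>P Q act. execution n k A P0 P Q act \<and> at_most_one_crash k act \<longrightarrow> gathered k P act))"

end

theory Submission
  imports Defs
begin

text \<open>All robots walk to one of the two occupied corners of the enclosing square, along paths
  that approach this target corner monotonically and avoid the other three corners. The square and
  the target never change, so nothing else has to be remembered once the other corner is empty or
  the target carries a multiplicity. Before that, the target is recognised as the corner that some
  robot off the corners is closer to than any such robot is to the other corner, with ties occurring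
  only in the initial configuration, where the missing symmetry decides. In this phase the robot on
  the other corner and the robots nearest to the target move. These are at least two robots, so one
  of them is correct, and the sum of the distances to the target decreases until all correct robots
  have arrived.\<close>

section \<open>Grid distance\<close>

definition adist :: "nat \<Rightarrow> nat \<Rightarrow> nat" where
  "adist i p = (if i \<le> p then p - i else i - p)"

definition mdist :: "node \<Rightarrow> node \<Rightarrow> nat" where
  "mdist u v = adist (fst u) (fst v) + adist (snd u) (snd v)"

lemma adist_triangle: "adist i k \<le> adist i j + adist j k"
  by (auto simp: adist_def)

lemma mdist_self [simp]: "mdist u u = 0"
  by (simp add: mdist_def adist_def)

lemma mdist_eq_0: "mdist u v = 0 \<longleftrightarrow> u = v"
  by (auto simp: mdist_def adist_def prod_eq_iff split: if_splits)

lemma mdist_triangle: "mdist u w \<le> mdist u v + mdist v w"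
  using adist_triangle[of "fst u" "fst w" "fst v"] adist_triangle[of "snd u" "snd w" "snd v"]
  unfolding mdist_def by linarith

lemma adist_eq_0: "adist i j = 0 \<longleftrightarrow> i = j"
  by (auto simp: adist_def)

lemma adist_eq_1: "adist i j = 1 \<longleftrightarrow> i = j + 1 \<or> j = i + 1"
  by (auto simp: adist_def)

lemma grid_adj_mdist: "grid_adj u v \<longleftrightarrow> mdist u v = 1"
  using adist_eq_0 adist_eq_1 unfolding grid_adj_def mdist_def
  by (metis (no_types, lifting) add.right_neutral add_0 add_is_1 One_nat_def)

definition toward :: "nat \<Rightarrow> nat \<Rightarrow> nat" where
  "toward p i = (if i < p then i + 1 else i - 1)"

lemma adist_toward: "i \<noteq> p \<Longrightarrow> adist (toward p i) p + 1 = adist i p"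
  by (auto simp: adist_def toward_def)

lemma toward_adj: "i \<noteq> p \<Longrightarrow> toward p i = i + 1 \<or> i = toward p i + 1"
  by (auto simp: toward_def)

lemma toward_between: "i \<noteq> p \<Longrightarrow> a \<le> i \<Longrightarrow> a \<le> p \<Longrightarrow> i \<le> b \<Longrightarrow> p \<le> b \<Longrightarrow>
    a \<le> toward p i \<and> toward p i \<le> b"
  by (auto simp: toward_def)

text \<open>Makes \<open>mdist\<close> the path metric of the grid, so that automorphisms, known
  only to preserve adjacency, can be shown to preserve distances.\<close>

lemma grid_step:
  assumes "u \<in> grid_nodes n" "v \<in> grid_nodes n" "u \<noteq> v"
  obtains w where "w \<in> grid_nodes n" "grid_adj u w" "mdist w v + 1 = mdist u v"
proof -
  obtain i j x y where uv: "u = (i, j)" "v = (x, y)" by fastforce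
  have b: "i < n" "j < n" "x < n" "y < n" using assms uv by (auto simp: grid_nodes_def)
  define w where "w = (if i \<noteq> x then (toward x i, j) else (i, toward y j))"
  have "w \<in> grid_nodes n" "grid_adj u w"
    using assms(3) b uv by (auto simp: w_def grid_nodes_def grid_adj_def toward_def)
  moreover have "mdist w v + 1 = mdist u v"
    using assms(3) uv adist_toward[of i x] adist_toward[of j y] by (auto simp: w_def mdist_def)
  ultimately show thesis using that by blast
qed

section \<open>Grid automorphisms are isometries\<close>

lemma grid_aut_in: "grid_aut n \<sigma> \<Longrightarrow> v \<in> grid_nodes n \<Longrightarrow> \<sigma> v \<in> grid_nodes n"
  by (auto simp: grid_aut_def bij_betw_def)

lemma grid_aut_id: "grid_aut n (\<lambda>v. v)"
  unfolding grid_aut_def by (auto simp: bij_betw_def)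

lemma grid_aut_comp:
  assumes "grid_aut n \<sigma>" "grid_aut n \<tau>"
  shows "grid_aut n (\<lambda>v. \<sigma> (\<tau> v))"
proof -
  have "bij_betw (\<lambda>v. \<sigma> (\<tau> v)) (grid_nodes n) (grid_nodes n)"
    using assms bij_betw_trans[of \<tau> "grid_nodes n" "grid_nodes n" \<sigma>]
    by (auto simp: grid_aut_def comp_def)
  then show ?thesis using assms grid_aut_in[OF assms(2)] unfolding grid_aut_def by metis
qed

lemma grid_aut_inv:
  assumes "grid_aut n \<sigma>"
  shows "grid_aut n (inv_into (grid_nodes n) \<sigma>)"
proof -
  have b: "bij_betw \<sigma> (grid_nodes n) (grid_nodes n)"
    and a: "\<forall>u \<in> grid_nodes n. \<forall>v \<in> grid_nodes n. grid_adj u v \<longleftrightarrow> grid_adj (\<sigma> u) (\<sigma> v)"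
    using assms by (auto simp: grid_aut_def)
  show ?thesis
    unfolding grid_aut_def
    using bij_betw_inv_into[OF b] a bij_betw_inv_into_right[OF b]
    by (smt (verit) bij_betwE)
qed

lemma grid_aut_inv_right:
  "grid_aut n \<sigma> \<Longrightarrow> v \<in> grid_nodes n \<Longrightarrow> \<sigma> (inv_into (grid_nodes n) \<sigma> v) = v"
  by (auto simp: grid_aut_def bij_betw_inv_into_right)

lemma grid_aut_inv_left:
  "grid_aut n \<sigma> \<Longrightarrow> v \<in> grid_nodes n \<Longrightarrow> inv_into (grid_nodes n) \<sigma> (\<sigma> v) = v"
  by (auto simp: grid_aut_def bij_betw_inv_into_left)

text \<open>A shortest path is mapped to a walk of the same length, so distances cannot grow. The
  inverse automorphism then yields equality.\<close>

lemma grid_aut_mdist_le: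
  assumes "grid_aut n \<sigma>" "u \<in> grid_nodes n" "v \<in> grid_nodes n"
  shows "mdist (\<sigma> u) (\<sigma> v) \<le> mdist u v"
  using assms(2)
proof (induction "mdist u v" arbitrary: u)
  case 0
  then show ?case by (simp add: mdist_eq_0)
next
  case (Suc d)
  then have "u \<noteq> v" by auto
  then obtain w where w: "w \<in> grid_nodes n" "grid_adj u w" "mdist w v + 1 = mdist u v"
    using grid_step Suc.prems assms(3) by blast
  have "mdist (\<sigma> w) (\<sigma> v) \<le> mdist w v" using Suc w by simp
  moreover have "mdist (\<sigma> u) (\<sigma> w) = 1"
    using assms(1) Suc.prems w(1,2) by (auto simp: grid_aut_def grid_adj_mdist)
  ultimately show ?case using mdist_triangle[of "\<sigma> u" "\<sigma> v" "\<sigma> w"] w(3) by linarith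
qed

lemma grid_aut_mdist:
  assumes "grid_aut n \<sigma>" "u \<in> grid_nodes n" "v \<in> grid_nodes n"
  shows "mdist (\<sigma> u) (\<sigma> v) = mdist u v"
  using grid_aut_mdist_le[OF assms] grid_aut_mdist_le[OF grid_aut_inv[OF assms(1)],
      of "\<sigma> u" "\<sigma> v"] assms
  by (simp add: grid_aut_in grid_aut_inv_left)

section \<open>Grid automorphisms as symmetries of a square\<close>

definition flip :: "nat \<Rightarrow> bool \<Rightarrow> nat \<Rightarrow> nat" where
  "flip n b i = (if b then n - 1 - i else i)"

lemma flip_interval:
  "i < n \<Longrightarrow> m \<le> flip n b i \<and> flip n b i + m < n \<longleftrightarrow> m \<le> i \<and> i + m < n"
  by (auto simp: flip_def)

lemma flip_end:
  "i < n \<Longrightarrow> 2 * m < n \<Longrightarrow> flip n b i \<in> {m, n - 1 - m} \<longleftrightarrow> i \<in> {m, n - 1 - m}"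
  by (auto simp: flip_def)

lemma adist_end:
  "p = 0 \<or> p = n - 1 \<Longrightarrow> i < n \<Longrightarrow> n \<ge> 2 \<Longrightarrow> adist i p = flip n (p = n - 1) i"
  by (auto simp: adist_def flip_def)

lemma adist_max: "i < n \<Longrightarrow> j < n \<Longrightarrow> adist i j \<le> n - 1"
  by (auto simp: adist_def)

lemma adist_max_ends: "i < n \<Longrightarrow> j < n \<Longrightarrow> adist i j = n - 1 \<Longrightarrow> i = 0 \<or> i = n - 1"
  by (auto simp: adist_def split: if_splits)

text \<open>Two opposite grid corners are mapped to opposite corners, being at maximal distance; the
  distances to the images of two adjacent corners then determine the coordinates.\<close>
lemma grid_aut_dihedral:
  assumes \<sigma>: "grid_aut n \<sigma>" and n: "n \<ge> 2"
  obtains s a b where "\<And>i j. i < n \<Longrightarrow> j < n \<Longrightarrow>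
    \<sigma> (i, j) = (if s then (flip n a j, flip n b i) else (flip n a i, flip n b j))"
proof -
  let ?N = "n - 1"
  have extreme: "(fst u = 0 \<or> fst u = ?N) \<and> (snd u = 0 \<or> snd u = ?N)"
    if "u \<in> grid_nodes n" "v \<in> grid_nodes n" "mdist u v = 2 * ?N" for u v
  proof -
    have l: "fst u < n" "snd u < n" "fst v < n" "snd v < n"
      using that by (auto simp: grid_nodes_def)
    have "adist (fst u) (fst v) = ?N" "adist (snd u) (snd v) = ?N"
      using that(3) adist_max[OF l(1,3)] adist_max[OF l(2,4)] unfolding mdist_def by linarith+
    then show ?thesis using adist_max_ends l by blast
  qed
  have g: "(0, 0) \<in> grid_nodes n" "(?N, 0) \<in> grid_nodes n" "(0, ?N) \<in> grid_nodes n"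
    "(?N, ?N) \<in> grid_nodes n" using n by (auto simp: grid_nodes_def)
  obtain p q where O: "\<sigma> (0, 0) = (p, q)" by fastforce
  obtain x y where X: "\<sigma> (?N, 0) = (x, y)" by fastforce
  have cO: "p = 0 \<or> p = ?N" "q = 0 \<or> q = ?N"
    using extreme[OF grid_aut_in[OF \<sigma> g(1)] grid_aut_in[OF \<sigma> g(4)]] grid_aut_mdist[OF \<sigma> g(1,4)] O
    by (auto simp: mdist_def adist_def)
  have cX: "x = 0 \<or> x = ?N" "y = 0 \<or> y = ?N"
    using extreme[OF grid_aut_in[OF \<sigma> g(2)] grid_aut_in[OF \<sigma> g(3)]] grid_aut_mdist[OF \<sigma> g(2,3)] X
    by (auto simp: mdist_def adist_def)
  have "mdist (p, q) (x, y) = mdist (0, 0) (?N, 0)"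
    using grid_aut_mdist[OF \<sigma> g(1,2)] O X by simp
  then have OX: "mdist (p, q) (x, y) = ?N" by (simp add: mdist_def adist_def)
  have adjacent: "x \<noteq> p \<and> y = q \<or> x = p \<and> y \<noteq> q"
    using OX cO cX n by (auto simp: mdist_def adist_def)
  show thesis
  proof (rule that[of "x = p" "p = ?N" "q = ?N"])
    fix i j assume ij: "i < n" "j < n"
    then have ijg: "(i, j) \<in> grid_nodes n" by (simp add: grid_nodes_def)
    obtain e f where ef: "\<sigma> (i, j) = (e, f)" by fastforce
    have efn: "e < n" "f < n"
      using grid_aut_in[OF \<sigma> ijg] ef by (auto simp: grid_nodes_def)
    \<comment> \<open>\<open>E\<close> and \<open>F\<close> measure how far the image is from the
      two grid sides that meet in the corner \<open>\<sigma> (0, 0)\<close>.\<close>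
    define E F where "E = flip n (p = ?N) e" and "F = flip n (q = ?N) f"
    have EF: "E < n" "F < n" "e = flip n (p = ?N) E" "f = flip n (q = ?N) F"
      using efn by (auto simp: E_def F_def flip_def)
    have "mdist (e, f) (p, q) = i + j"
      using grid_aut_mdist[OF \<sigma> ijg g(1)] ef O by (simp add: mdist_def adist_def)
    then have 1: "E + F = i + j"
      using adist_end[OF cO(1) efn(1) n] adist_end[OF cO(2) efn(2) n]
      by (simp add: mdist_def E_def F_def)
    have "mdist (e, f) (x, y) = mdist (i, j) (?N, 0)"
      using grid_aut_mdist[OF \<sigma> ijg g(2)] ef X by simp
    also have "\<dots> = (?N - i) + j" using ij by (auto simp: mdist_def adist_def)
    finally have 2: "flip n (x = ?N) e + flip n (y = ?N) f = (?N - i) + j"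
      using adist_end[OF cX(1) efn(1) n] adist_end[OF cX(2) efn(2) n]
      unfolding mdist_def fst_conv snd_conv by linarith
    have flip_other: "flip n (x = ?N) e = ?N - E" if "x \<noteq> p"
      using that cO(1) cX(1) efn n unfolding E_def flip_def by auto
    have flip_other': "flip n (y = ?N) f = ?N - F" if "y \<noteq> q"
      using that cO(2) cX(2) efn n unfolding F_def flip_def by auto
    have "if x = p then E = j \<and> F = i else E = i \<and> F = j"
      using adjacent
    proof
      assume h: "x \<noteq> p \<and> y = q"
      then have "(?N - E) + F = (?N - i) + j" using 2 flip_other by (simp add: F_def)
      then show ?thesis using h 1 EF ij by auto
    next
      assume h: "x = p \<and> y \<noteq> q"
      then have "E + (?N - F) = (?N - i) + j" using 2 flip_other' by (simp add: E_def)
      then show ?thesis using h 1 EF ij by auto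
    qed
    then show "\<sigma> (i, j) = (if x = p then (flip n (p = ?N) j, flip n (q = ?N) i)
      else (flip n (p = ?N) i, flip n (q = ?N) j))"
      using ef EF by (auto split: if_splits)
  qed
qed

section \<open>Concentric squares and steps toward a corner\<close>

definition sq_corners :: "nat \<Rightarrow> nat \<Rightarrow> node set" where
  "sq_corners n m = {m, n - 1 - m} \<times> {m, n - 1 - m}"

lemma grid_aut_in_sq:
  assumes "grid_aut n \<sigma>" "n \<ge> 2" "v \<in> grid_nodes n"
  shows "in_sq n m (\<sigma> v) \<longleftrightarrow> in_sq n m v"
proof -
  obtain i j where v: "v = (i, j)" "i < n" "j < n" using assms(3) by (auto simp: grid_nodes_def)
  obtain s a b where "\<And>i j. i < n \<Longrightarrow> j < n \<Longrightarrow>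
    \<sigma> (i, j) = (if s then (flip n a j, flip n b i) else (flip n a i, flip n b j))"
    using grid_aut_dihedral[OF assms(1,2)] by metis
  from this[OF v(2,3)] show ?thesis using v flip_interval[of i n m] flip_interval[of j n m]
    by (cases s) (auto simp: in_sq_def)
qed

lemma grid_aut_sq_corners:
  assumes "grid_aut n \<sigma>" "n \<ge> 2" "v \<in> grid_nodes n" "2 * m < n"
  shows "\<sigma> v \<in> sq_corners n m \<longleftrightarrow> v \<in> sq_corners n m"
proof -
  obtain i j where v: "v = (i, j)" "i < n" "j < n" using assms(3) by (auto simp: grid_nodes_def)
  obtain s a b where "\<And>i j. i < n \<Longrightarrow> j < n \<Longrightarrow>
    \<sigma> (i, j) = (if s then (flip n a j, flip n b i) else (flip n a i, flip n b j))"
    using grid_aut_dihedral[OF assms(1,2)] by metis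
  from this[OF v(2,3)] show ?thesis
    using v(1) flip_end[OF v(2) assms(4)] flip_end[OF v(3) assms(4)]
    unfolding sq_corners_def by (cases s) (simp_all only: if_True if_False mem_Sigma_iff conj_commute)
qed

text \<open>Only squares of side at least four leave room for avoiding the three other corners.\<close>
lemma corner_step:
  assumes c: "c \<in> sq_corners n m" and u: "in_sq n m u" "u \<noteq> c" and m: "2 * m + 4 \<le> n"
  obtains w where "w \<in> grid_nodes n" "grid_adj u w" "mdist w c < mdist u c" "in_sq n m w"
    "w \<in> sq_corners n m \<Longrightarrow> w = c"
proof -
  define N where "N = n - 1 - m"
  have N: "n = N + m + 1" "N \<ge> m + 3" using m by (auto simp: N_def)
  obtain i j p q where e: "u = (i, j)" "c = (p, q)" by fastforce
  have ij: "m \<le> i" "i \<le> N" "m \<le> j" "j \<le> N" using u N e by (auto simp: in_sq_def)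
  have pq: "p = m \<or> p = N" "q = m \<or> q = N" using c e by (auto simp: sq_corners_def N_def)
  \<comment> \<open>The first coordinate moves if it has to, unless this would end in a wrong
    corner. In that exceptional case \<open>i\<close> lies strictly between \<open>m\<close> and
    \<open>N\<close>, so changing the second coordinate reaches no corner at all.\<close>
  define w where
    "w = (if i \<noteq> p \<and> (toward p i \<in> {m, N} \<longrightarrow> j \<in> {m, N} \<longrightarrow> j = q) then (toward p i, j)
      else (i, toward q j))"
  have tp: "toward p i = p \<and> i \<notin> {m, N}" if "i \<noteq> p" "toward p i \<in> {m, N}"
    using that pq(1) ij N(2) by (auto simp: toward_def split: if_splits)
  have tq: "toward q j = q" if "j \<noteq> q" "toward q j \<in> {m, N}"
    using that pq(2) ij N(2) by (auto simp: toward_def split: if_splits)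
  have cases: "i \<noteq> p \<and> w = (toward p i, j) \<or> j \<noteq> q \<and> w = (i, toward q j)"
    using u(2) e by (auto simp: w_def)
  have bp: "m \<le> toward p i \<and> toward p i \<le> N" if "i \<noteq> p"
    using toward_between[OF that, of m N] pq ij by auto
  have bq: "m \<le> toward q j \<and> toward q j \<le> N" if "j \<noteq> q"
    using toward_between[OF that, of m N] pq ij by auto
  have sq: "in_sq n m w" using cases bp bq ij N(1) by (auto simp: in_sq_def)
  moreover have "w \<in> grid_nodes n" using sq by (cases w) (auto simp: in_sq_def grid_nodes_def)
  moreover have "grid_adj u w"
    using cases toward_adj[of i p] toward_adj[of j q] e by (auto simp: grid_adj_def)
  moreover have "mdist w c < mdist u c"
    using cases adist_toward[of i p] adist_toward[of j q] e by (auto simp: mdist_def)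
  moreover have "w = c" if "w \<in> sq_corners n m"
    using that tp tq u(2) e pq unfolding w_def sq_corners_def N_def[symmetric]
    by (auto split: if_splits)
  ultimately show thesis using that by blast
qed

text \<open>Distances to adjacent corners of an even square have different parities, and distances to
  opposite corners have a constant sum.\<close>
lemma corner_step_strict:
  assumes "c \<in> sq_corners n m" "c' \<in> sq_corners n m" "c \<noteq> c'" "even n" "2 * m + 4 \<le> n"
    "in_sq n m u" "in_sq n m w" "grid_adj u w" "mdist w c < mdist u c" "mdist u c \<le> mdist u c'"
  shows "mdist w c < mdist w c'"
proof -
  define N where "N = n - 1 - m"
  define l where "l = N - m"
  have l: "odd l" "N = m + l" "l \<ge> 3"
    using assms(4,5) by (auto simp: l_def N_def)
  obtain p q x y where e: "c = (p, q)" "c' = (x, y)" by fastforce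
  have pq: "p = m \<or> p = N" "q = m \<or> q = N" "x = m \<or> x = N" "y = m \<or> y = N"
    using assms(1,2) e by (auto simp: sq_corners_def N_def)
  have other: "adist i p + adist i x = l" if "p \<noteq> x" "m \<le> i" "i \<le> N" for i
    using that pq(1,3) l(2) by (auto simp: adist_def)
  have other': "adist j q + adist j y = l" if "q \<noteq> y" "m \<le> j" "j \<le> N" for j
    using that pq(2,4) l(2) by (auto simp: adist_def)
  have bound: "m \<le> fst v \<and> fst v \<le> N \<and> m \<le> snd v \<and> snd v \<le> N" if "in_sq n m v" for v
    using that by (auto simp: in_sq_def N_def)
  \<comment> \<open>For opposite corners each coordinate contributes \<open>l\<close>. For adjacent
    corners one coordinate contributes the odd number \<open>l\<close> and the other twice the same
    distance.\<close>
  have dist: "if p \<noteq> x \<and> q \<noteq> y then mdist v c + mdist v c' = 2 * l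
    else odd (mdist v c + mdist v c')" if v: "in_sq n m v" for v
    using other[of "fst v"] other'[of "snd v"] bound[OF v] assms(3) l(1) e
    unfolding mdist_def by (auto simp: algebra_simps)
  have "mdist u c' \<le> mdist w c' + 1"
    using mdist_triangle[of u c' w] assms(8) by (simp add: grid_adj_mdist)
  \<comment> \<open>With a constant sum, approaching \<open>c\<close> means receding from
    \<open>c'\<close>. With an odd sum only equality is left to be excluded, and parity does
    that.\<close>
  then show ?thesis
    using dist[OF assms(6)] dist[OF assms(7)] assms(9,10)
    by (cases "p \<noteq> x \<and> q \<noteq> y") (simp_all, presburger+)
qed

section \<open>Reindexing along automorphisms, and the algorithm\<close>

lemma grid_aut_surj: "grid_aut n \<sigma> \<Longrightarrow> \<sigma> ` grid_nodes n = grid_nodes n"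
  by (simp add: grid_aut_def bij_betw_def)

lemma grid_aut_ball:
  "grid_aut n \<sigma> \<Longrightarrow> (\<forall>y \<in> grid_nodes n. Q (\<sigma> y)) \<longleftrightarrow> (\<forall>y \<in> grid_nodes n. Q y)"
  by (subst (2) grid_aut_surj[symmetric]) auto

lemma grid_aut_bex:
  "grid_aut n \<sigma> \<Longrightarrow> (\<exists>y \<in> grid_nodes n. Q (\<sigma> y)) \<longleftrightarrow> (\<exists>y \<in> grid_nodes n. Q y)"
  by (subst (2) grid_aut_surj[symmetric]) auto

lemma grid_aut_eq_iff:
  "grid_aut n \<sigma> \<Longrightarrow> u \<in> grid_nodes n \<Longrightarrow> v \<in> grid_nodes n \<Longrightarrow> \<sigma> u = \<sigma> v \<longleftrightarrow> u = v"
  by (metis grid_aut_inv_left)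

lemma in_sq_grid: "in_sq n m v \<Longrightarrow> v \<in> grid_nodes n"
  by (cases v) (auto simp: in_sq_def grid_nodes_def)

lemma sq_corners_grid: "2 * m < n \<Longrightarrow> c \<in> sq_corners n m \<Longrightarrow> c \<in> grid_nodes n"
  by (auto simp: sq_corners_def grid_nodes_def)

text \<open>A comparison of two minima, phrased by quantifiers so that it is simply false when no
  robot is off the corners.\<close>

definition closer :: "nat \<Rightarrow> nat \<Rightarrow> (node \<Rightarrow> nat) \<Rightarrow> node \<Rightarrow> node \<Rightarrow> bool" where
  "closer n m f a b \<longleftrightarrow> (\<exists>z \<in> grid_nodes n. z \<notin> sq_corners n m \<and> f z \<noteq> 0 \<and>
     (\<forall>y \<in> grid_nodes n. y \<notin> sq_corners n m \<and> f y \<noteq> 0 \<longrightarrow> mdist z a < mdist y b))"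

text \<open>Recognises the initial configuration together with its chosen corner in any local frame.
  The algorithm may be tailored to the initial configuration, and this is how it resolves a tie
  there.\<close>

definition iso_conf :: "nat \<Rightarrow> (node \<Rightarrow> nat) \<Rightarrow> node \<Rightarrow> (node \<Rightarrow> nat) \<Rightarrow> node \<Rightarrow> bool" where
  "iso_conf n f0 c0 f a \<longleftrightarrow>
     (\<exists>\<sigma>. grid_aut n \<sigma> \<and> (\<forall>v \<in> grid_nodes n. f v = f0 (\<sigma> v)) \<and> \<sigma> a = c0)"

text \<open>The demand \<open>f b = 1\<close> keeps a corner with a single robot from prevailing
  over a multiplicity. If no other corner is occupied, the quantified condition is vacuous.\<close>

definition target :: "nat \<Rightarrow> nat \<Rightarrow> (node \<Rightarrow> nat) \<Rightarrow> node \<Rightarrow> (node \<Rightarrow> nat) \<Rightarrow> node \<Rightarrow> bool" where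
  "target n m f0 c0 f a \<longleftrightarrow> a \<in> sq_corners n m \<and> f a \<noteq> 0 \<and>
     (\<forall>b \<in> grid_nodes n. b \<in> sq_corners n m \<and> b \<noteq> a \<and> f b \<noteq> 0 \<longrightarrow>
        f a = 2 \<or> f b = 1 \<and> (closer n m f a b \<or> iso_conf n f0 c0 f a))"

text \<open>The threshold is the least distance to the other corner, not the least distance to
  \<open>a\<close>: any robot within it, once moved closer to \<open>a\<close>, beats all those
  distances strictly and so establishes \<open>closer\<close>.\<close>

definition mover :: "nat \<Rightarrow> nat \<Rightarrow> (node \<Rightarrow> nat) \<Rightarrow> node \<Rightarrow> node \<Rightarrow> bool" where
  "mover n m f a u \<longleftrightarrow> u \<noteq> a \<and> (u \<in> sq_corners n m \<or> f a = 2 \<or>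
     (\<forall>b \<in> grid_nodes n. b \<in> sq_corners n m \<and> b \<noteq> a \<and> f b \<noteq> 0 \<longrightarrow>
        (\<forall>y \<in> grid_nodes n. y \<notin> sq_corners n m \<and> f y \<noteq> 0 \<longrightarrow> mdist u a \<le> mdist y b)))"

definition good_step ::
  "nat \<Rightarrow> nat \<Rightarrow> (node \<Rightarrow> nat) \<Rightarrow> node \<Rightarrow> (node \<Rightarrow> nat) \<Rightarrow> node \<Rightarrow> node \<Rightarrow> bool" where
  "good_step n m f0 c0 f u w \<longleftrightarrow> w \<in> grid_nodes n \<and> (\<exists>a \<in> grid_nodes n.
     target n m f0 c0 f a \<and> mover n m f a u \<and> grid_adj u w \<and> mdist w a < mdist u a \<and>
     in_sq n m w \<and> (w \<in> sq_corners n m \<longrightarrow> w = a))"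

text \<open>The choice need not commute with automorphisms. Only the relation
  \<open>good_step\<close> does, and which good step is taken may depend on the frame.\<close>

definition corner_algo :: "nat \<Rightarrow> nat \<Rightarrow> (node \<Rightarrow> nat) \<Rightarrow> node \<Rightarrow> algo" where
  "corner_algo n m f0 c0 g u =
     (if \<exists>w. good_step n m f0 c0 g u w then SOME w. good_step n m f0 c0 g u w else u)"

lemma valid_corner_algo: "valid_algo n (corner_algo n m f0 c0)"
  unfolding valid_algo_def corner_algo_def good_step_def
  by (auto intro: someI2_ex)

section \<open>Independence of the algorithm from the local frame\<close>

context
  fixes n m :: nat and \<sigma> :: "node \<Rightarrow> node" and f g :: "node \<Rightarrow> nat"
  assumes aut: "grid_aut n \<sigma>" and n: "n \<ge> 2" and m: "2 * m < n"
    and fg: "\<forall>v \<in> grid_nodes n. f v = g (\<sigma> v)"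
begin

lemma closer_aut:
  assumes "a \<in> grid_nodes n" "b \<in> grid_nodes n"
  shows "closer n m f a b \<longleftrightarrow> closer n m g (\<sigma> a) (\<sigma> b)"
proof -
  have in_corner: "\<sigma> y \<in> sq_corners n m \<longleftrightarrow> y \<in> sq_corners n m" if "y \<in> grid_nodes n" for y
    using grid_aut_sq_corners[OF aut n that m] .
  have "(\<forall>y \<in> grid_nodes n. y \<notin> sq_corners n m \<and> f y \<noteq> 0 \<longrightarrow> mdist z a < mdist y b) \<longleftrightarrow>
      (\<forall>y \<in> grid_nodes n. y \<notin> sq_corners n m \<and> g y \<noteq> 0 \<longrightarrow> mdist (\<sigma> z) (\<sigma> a) < mdist y (\<sigma> b))"
    if "z \<in> grid_nodes n" for z
    using assms that fg in_corner grid_aut_mdist[OF aut]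
    by (subst (2) grid_aut_ball[OF aut, symmetric]) (simp cong: ball_cong)
  then have "closer n m f a b \<longleftrightarrow> (\<exists>z \<in> grid_nodes n. \<sigma> z \<notin> sq_corners n m \<and> g (\<sigma> z) \<noteq> 0 \<and>
      (\<forall>y \<in> grid_nodes n. y \<notin> sq_corners n m \<and> g y \<noteq> 0 \<longrightarrow> mdist (\<sigma> z) (\<sigma> a) < mdist y (\<sigma> b)))"
    unfolding closer_def using fg in_corner by simp
  also note grid_aut_bex[OF aut, of "\<lambda>z. z \<notin> sq_corners n m \<and> g z \<noteq> 0 \<and>
      (\<forall>y \<in> grid_nodes n. y \<notin> sq_corners n m \<and> g y \<noteq> 0 \<longrightarrow> mdist z (\<sigma> a) < mdist y (\<sigma> b))"]
  finally show ?thesis unfolding closer_def .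
qed

lemma iso_conf_aut:
  assumes "a \<in> grid_nodes n"
  shows "iso_conf n f0 c0 f a \<longleftrightarrow> iso_conf n f0 c0 g (\<sigma> a)"
proof
  assume "iso_conf n f0 c0 f a"
  then obtain \<tau> where \<tau>: "grid_aut n \<tau>" "\<forall>v \<in> grid_nodes n. f v = f0 (\<tau> v)" "\<tau> a = c0"
    by (auto simp: iso_conf_def)
  let ?\<rho> = "\<lambda>v. \<tau> (inv_into (grid_nodes n) \<sigma> v)"
  have "g v = f0 (?\<rho> v)" if "v \<in> grid_nodes n" for v
    using that \<tau>(2) fg grid_aut_in[OF grid_aut_inv[OF aut]] grid_aut_inv_right[OF aut] by metis
  moreover have "?\<rho> (\<sigma> a) = c0" using \<tau>(3) grid_aut_inv_left[OF aut assms] by simp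
  ultimately show "iso_conf n f0 c0 g (\<sigma> a)"
    using grid_aut_comp[OF \<tau>(1) grid_aut_inv[OF aut]] unfolding iso_conf_def by blast
next
  assume "iso_conf n f0 c0 g (\<sigma> a)"
  then obtain \<tau> where \<tau>: "grid_aut n \<tau>" "\<forall>v \<in> grid_nodes n. g v = f0 (\<tau> v)" "\<tau> (\<sigma> a) = c0"
    by (auto simp: iso_conf_def)
  then show "iso_conf n f0 c0 f a"
    using grid_aut_comp[OF \<tau>(1) aut] fg grid_aut_in[OF aut] unfolding iso_conf_def
    by (intro exI[of _ "\<lambda>v. \<tau> (\<sigma> v)"]) auto
qed

lemma target_aut:
  assumes "a \<in> grid_nodes n"
  shows "target n m f0 c0 f a \<longleftrightarrow> target n m f0 c0 g (\<sigma> a)"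
proof -
  have "(b \<in> sq_corners n m \<and> b \<noteq> a \<and> f b \<noteq> 0 \<longrightarrow>
        f a = 2 \<or> f b = 1 \<and> (closer n m f a b \<or> iso_conf n f0 c0 f a)) \<longleftrightarrow>
      (\<sigma> b \<in> sq_corners n m \<and> \<sigma> b \<noteq> \<sigma> a \<and> g (\<sigma> b) \<noteq> 0 \<longrightarrow>
        g (\<sigma> a) = 2 \<or> g (\<sigma> b) = 1 \<and> (closer n m g (\<sigma> a) (\<sigma> b) \<or> iso_conf n f0 c0 g (\<sigma> a)))"
    if "b \<in> grid_nodes n" for b
    using that assms fg grid_aut_sq_corners[OF aut n that m] grid_aut_eq_iff[OF aut that assms]
      closer_aut[OF assms that] iso_conf_aut[OF assms] by simp
  then have "(\<forall>b \<in> grid_nodes n. b \<in> sq_corners n m \<and> b \<noteq> a \<and> f b \<noteq> 0 \<longrightarrow>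
        f a = 2 \<or> f b = 1 \<and> (closer n m f a b \<or> iso_conf n f0 c0 f a)) \<longleftrightarrow>
      (\<forall>b \<in> grid_nodes n. \<sigma> b \<in> sq_corners n m \<and> \<sigma> b \<noteq> \<sigma> a \<and> g (\<sigma> b) \<noteq> 0 \<longrightarrow>
        g (\<sigma> a) = 2 \<or> g (\<sigma> b) = 1 \<and> (closer n m g (\<sigma> a) (\<sigma> b) \<or> iso_conf n f0 c0 g (\<sigma> a)))"
    by (rule ball_cong[OF refl])
  also note grid_aut_ball[OF aut, of "\<lambda>b. b \<in> sq_corners n m \<and> b \<noteq> \<sigma> a \<and> g b \<noteq> 0 \<longrightarrow>
        g (\<sigma> a) = 2 \<or> g b = 1 \<and> (closer n m g (\<sigma> a) b \<or> iso_conf n f0 c0 g (\<sigma> a))"]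
  finally show ?thesis
    unfolding target_def using assms fg grid_aut_sq_corners[OF aut n assms m] by simp
qed

lemma mover_aut:
  assumes "a \<in> grid_nodes n" "u \<in> grid_nodes n"
  shows "mover n m f a u \<longleftrightarrow> mover n m g (\<sigma> a) (\<sigma> u)"
proof -
  have in_corner: "\<sigma> b \<in> sq_corners n m \<longleftrightarrow> b \<in> sq_corners n m" if "b \<in> grid_nodes n" for b
    using grid_aut_sq_corners[OF aut n that m] .
  have "(\<forall>y \<in> grid_nodes n. y \<notin> sq_corners n m \<and> f y \<noteq> 0 \<longrightarrow> mdist u a \<le> mdist y b) \<longleftrightarrow>
      (\<forall>y \<in> grid_nodes n. y \<notin> sq_corners n m \<and> g y \<noteq> 0 \<longrightarrow> mdist (\<sigma> u) (\<sigma> a) \<le> mdist y (\<sigma> b))"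
    if "b \<in> grid_nodes n" for b
    using assms that fg in_corner grid_aut_mdist[OF aut]
    by (subst (2) grid_aut_ball[OF aut, symmetric]) (simp cong: ball_cong)
  then have "(\<forall>b \<in> grid_nodes n. b \<in> sq_corners n m \<and> b \<noteq> a \<and> f b \<noteq> 0 \<longrightarrow>
        (\<forall>y \<in> grid_nodes n. y \<notin> sq_corners n m \<and> f y \<noteq> 0 \<longrightarrow> mdist u a \<le> mdist y b)) \<longleftrightarrow>
      (\<forall>b \<in> grid_nodes n. \<sigma> b \<in> sq_corners n m \<and> \<sigma> b \<noteq> \<sigma> a \<and> g (\<sigma> b) \<noteq> 0 \<longrightarrow>
        (\<forall>y \<in> grid_nodes n. y \<notin> sq_corners n m \<and> g y \<noteq> 0 \<longrightarrow>
          mdist (\<sigma> u) (\<sigma> a) \<le> mdist y (\<sigma> b)))"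
    using assms fg in_corner grid_aut_eq_iff[OF aut] by simp
  also note grid_aut_ball[OF aut, of "\<lambda>b. b \<in> sq_corners n m \<and> b \<noteq> \<sigma> a \<and> g b \<noteq> 0 \<longrightarrow>
        (\<forall>y \<in> grid_nodes n. y \<notin> sq_corners n m \<and> g y \<noteq> 0 \<longrightarrow> mdist (\<sigma> u) (\<sigma> a) \<le> mdist y b)"]
  finally show ?thesis
    unfolding mover_def using assms fg in_corner grid_aut_eq_iff[OF aut] by simp
qed

lemma good_step_aut:
  assumes u: "u \<in> grid_nodes n" and w: "w \<in> grid_nodes n"
  shows "good_step n m f0 c0 f u w \<longleftrightarrow> good_step n m f0 c0 g (\<sigma> u) (\<sigma> w)"
proof -
  have "(target n m f0 c0 f a \<and> mover n m f a u \<and> grid_adj u w \<and> mdist w a < mdist u a \<and>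
      in_sq n m w \<and> (w \<in> sq_corners n m \<longrightarrow> w = a)) \<longleftrightarrow>
      (target n m f0 c0 g (\<sigma> a) \<and> mover n m g (\<sigma> a) (\<sigma> u) \<and> grid_adj (\<sigma> u) (\<sigma> w) \<and>
      mdist (\<sigma> w) (\<sigma> a) < mdist (\<sigma> u) (\<sigma> a) \<and>
      in_sq n m (\<sigma> w) \<and> (\<sigma> w \<in> sq_corners n m \<longrightarrow> \<sigma> w = \<sigma> a))"
    if a: "a \<in> grid_nodes n" for a
    using target_aut[OF a] mover_aut[OF a u] grid_aut_mdist[OF aut] u w a
      grid_aut_sq_corners[OF aut n w m] grid_aut_in_sq[OF aut n w] grid_aut_eq_iff[OF aut w a]
    by (simp add: grid_adj_mdist)
  then show ?thesis
    unfolding good_step_def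
    using w grid_aut_in[OF aut w] grid_aut_bex[OF aut, of "\<lambda>a. target n m f0 c0 g a \<and>
      mover n m g a (\<sigma> u) \<and> grid_adj (\<sigma> u) (\<sigma> w) \<and> mdist (\<sigma> w) a < mdist (\<sigma> u) a \<and>
      in_sq n m (\<sigma> w) \<and> (\<sigma> w \<in> sq_corners n m \<longrightarrow> \<sigma> w = a)"]
    by (simp cong: bex_cong)
qed

end

text \<open>Brings the decision back to global coordinates, after which frames no longer matter.
  That a robot stays only for lack of a good step is what progress needs.\<close>

lemma corner_algo_look:
  assumes aut: "grid_aut n \<sigma>" and n: "n \<ge> 2" and m: "2 * m < n" and u: "u \<in> grid_nodes n"
    and d: "d = \<sigma> (corner_algo n m f0 c0 (view n \<sigma> f) (inv_into (grid_nodes n) \<sigma> u))"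
  shows "good_step n m f0 c0 f u d \<or> d = u \<and> (\<nexists>w. good_step n m f0 c0 f u w)"
proof -
  let ?l = "inv_into (grid_nodes n) \<sigma> u"
  have l: "?l \<in> grid_nodes n" "\<sigma> ?l = u"
    using grid_aut_in[OF grid_aut_inv[OF aut] u] grid_aut_inv_right[OF aut u] .
  have fg: "\<forall>v \<in> grid_nodes n. view n \<sigma> f v = f (\<sigma> v)" by (simp add: view_def)
  have eq: "good_step n m f0 c0 (view n \<sigma> f) ?l w \<longleftrightarrow> good_step n m f0 c0 f u (\<sigma> w)"
    if "w \<in> grid_nodes n" for w
    using good_step_aut[OF aut n m fg l(1) that] l(2) by simp
  show ?thesis
  proof (cases "\<exists>w. good_step n m f0 c0 (view n \<sigma> f) ?l w")
    case True
    then have "good_step n m f0 c0 (view n \<sigma> f) ?l (corner_algo n m f0 c0 (view n \<sigma> f) ?l)"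
      using someI_ex[OF True] by (simp add: corner_algo_def)
    moreover from this have "corner_algo n m f0 c0 (view n \<sigma> f) ?l \<in> grid_nodes n"
      unfolding good_step_def by blast
    ultimately show ?thesis using eq d by simp
  next
    case False
    then have "d = u" using d l(2) by (auto simp: corner_algo_def)
    moreover have "\<not> good_step n m f0 c0 f u w" for w
    proof
      assume w: "good_step n m f0 c0 f u w"
      then have "w \<in> grid_nodes n" by (simp add: good_step_def)
      then have "good_step n m f0 c0 (view n \<sigma> f) ?l (inv_into (grid_nodes n) \<sigma> w)"
        using eq w grid_aut_in[OF grid_aut_inv[OF aut]] grid_aut_inv_right[OF aut] by simp
      then show False using False by blast
    qed
    ultimately show ?thesis by blast
  qed
qed

section \<open>Configurations in terms of robots\<close>

lemma conf_eq_0_iff: "conf k P v = 0 \<longleftrightarrow> (\<forall>r<k. P r \<noteq> v)"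
  by (auto simp: conf_def Let_def)

lemma conf_eq_1_iff: "conf k P v = 1 \<longleftrightarrow> (\<exists>!r. r < k \<and> P r = v)"
proof -
  have "conf k P v = 1 \<longleftrightarrow> card {r. r < k \<and> P r = v} = 1"
    unfolding conf_def Let_def by presburger
  also have "\<dots> \<longleftrightarrow> (\<exists>!r. r < k \<and> P r = v)"
    by (simp add: card_1_singleton_iff set_eq_iff Ex1_def) blast
  finally show ?thesis .
qed

lemma conf_values: "conf k P v = 0 \<or> conf k P v = 1 \<or> conf k P v = 2"
  by (simp add: conf_def Let_def)

lemma closer_conf:
  assumes "\<forall>r<k. P r \<in> grid_nodes n"
  shows "closer n m (conf k P) a b \<longleftrightarrow> (\<exists>i<k. P i \<notin> sq_corners n m \<and>
    (\<forall>j<k. P j \<notin> sq_corners n m \<longrightarrow> mdist (P i) a < mdist (P j) b))"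
  unfolding closer_def conf_eq_0_iff using assms by blast

text \<open>The two witnesses would form a cycle of strict inequalities. Hence the two occupied
  corners can be named so that \<open>c'\<close> is not closer.\<close>

lemma closer_asym: "closer n m f a b \<Longrightarrow> closer n m f b a \<Longrightarrow> False"
  unfolding closer_def by (meson less_asym less_trans)

section \<open>Symmetries that exchange the occupied corners\<close>

lemma partitive_involution:
  assumes "conf_aut n f \<phi>" "\<forall>v \<in> grid_nodes n. \<phi> (\<phi> v) = v" "\<forall>v \<in> grid_nodes n. \<phi> v \<noteq> v"
    "n > 0"
  shows "partitive n f"
proof -
  have pow: "(\<phi> ^^ i) v = (if even i then v else \<phi> v)" if "v \<in> grid_nodes n" for i v
    using that assms(2) by (induction i) auto
  have "card {(\<phi> ^^ i) v | i. True} = 2" if v: "v \<in> grid_nodes n" for v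
  proof -
    have "{(\<phi> ^^ i) v | i. True} = {v, \<phi> v}"
      unfolding pow[OF v] by (auto intro: exI[of _ "0::nat"] exI[of _ "1::nat"])
    then show ?thesis using assms(3) v by (metis card_2_iff)
  qed
  moreover have "(0, 0) \<in> grid_nodes n" using assms(4) by (simp add: grid_nodes_def)
  ultimately show ?thesis
    unfolding partitive_def using assms(1,3) pow
    by (intro exI[of _ \<phi>] exI[of _ "2::nat"] conjI) (force simp: less_2_cases_iff)+
qed

lemma flip_flip: "i < n \<Longrightarrow> flip n b (flip n b i) = i"
  by (auto simp: flip_def)

lemma flip_neq: "even n \<Longrightarrow> i < n \<Longrightarrow> flip n True i \<noteq> i"
  unfolding flip_def by presburger

lemma flip_less: "i < n \<Longrightarrow> flip n b i < n"
  by (auto simp: flip_def)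

lemma mes_corners_eq: "mes_corners n f = sq_corners n (mes n f)"
  by (auto simp: mes_corners_def mes_c1_def mes_c2_def mes_c3_def mes_c4_def sq_corners_def)

text \<open>An automorphism exchanging the occupied corners is either a fixed point free involution or
  the reflection in the diagonal through the other two corners, since a quarter turn would move
  the pair of corners.\<close>
lemma no_corner_swap:
  assumes n: "even n" "n \<ge> 2" and m: "2 * mes n f < n"
    and occ: "{v \<in> mes_corners n f. f v \<noteq> 0} = {c, c'}" "c \<noteq> c'"
    and np: "\<not> partitive n f" and n2: "\<not> is_2S2 n f"
    and aut: "grid_aut n \<sigma>" "\<forall>v \<in> grid_nodes n. f (\<sigma> v) = f v"
  shows "\<sigma> c' \<noteq> c"
proof
  assume sc': "\<sigma> c' = c"
  define m N where "m = mes n f" and "N = n - 1 - mes n f"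
  have N: "N = n - 1 - m" "m < n" "N < n" "n - 1 - N = m" "n - 1 - m = N"
    using n m unfolding m_def N_def by linarith+
  have "n = m + N + 1" using N(1,2) by simp
  then have "m \<noteq> N" using n(1) by auto
  have corners: "c \<in> sq_corners n m" "c' \<in> sq_corners n m" "f c \<noteq> 0" "f c' \<noteq> 0"
    using occ(1) by (auto simp: mes_corners_eq m_def)
  have cg: "c \<in> grid_nodes n" "c' \<in> grid_nodes n"
    using corners sq_corners_grid m by (auto simp: m_def)
  \<comment> \<open>\<open>\<sigma>\<close> permutes the two occupied corners, so sending
    \<open>c'\<close> to \<open>c\<close> it must exchange them.\<close>
  have "\<sigma> c \<in> {c, c'}"
    using grid_aut_sq_corners[OF aut(1) n(2) cg(1) m] corners(1,3) aut(2) cg(1)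
    unfolding occ(1)[symmetric] mes_corners_eq m_def by simp
  then have sc: "\<sigma> c = c'" using grid_aut_eq_iff[OF aut(1) cg] sc' occ(2) by auto
  obtain s a b where \<sigma>: "\<And>i j. i < n \<Longrightarrow> j < n \<Longrightarrow>
    \<sigma> (i, j) = (if s then (flip n a j, flip n b i) else (flip n a i, flip n b j))"
    using grid_aut_dihedral[OF aut(1) n(2)] by metis
  obtain x y where c': "c' = (x, y)" by fastforce
  have xy: "x = m \<or> x = N" "y = m \<or> y = N" using corners(2) c' N by (auto simp: sq_corners_def)
  then have xyn: "x < n" "y < n" using N by auto
  show False
  proof (cases s)
    case False
    \<comment> \<open>Here \<open>\<sigma>\<close> is the identity, the half turn or a reflection in
      a central axis parallel to a side. All but the identity fix no node, since an even range has
      no middle.\<close>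
    have "\<sigma> (x, y) = (x, y)" if "\<not> a" "\<not> b" using \<sigma>[OF xyn] False that by (simp add: flip_def)
    then have "a \<or> b" using sc' c' occ(2) by auto
    then have "\<sigma> v \<noteq> v" if "v \<in> grid_nodes n" for v
      using that \<sigma> False flip_neq[OF n(1)] by (cases v) (auto simp: grid_nodes_def)
    moreover have "\<sigma> (\<sigma> v) = v" if "v \<in> grid_nodes n" for v
      using that \<sigma> False flip_less flip_flip by (cases v) (auto simp: grid_nodes_def)
    ultimately show False
      using partitive_involution[of n f \<sigma>] np aut n(2) by (auto simp: conf_aut_def)
  next
    case True
    have c: "c = (flip n a y, flip n b x)" using \<sigma>[OF xyn] True sc' c' by simp
    \<comment> \<open>Applying \<open>\<sigma>\<close> twice to \<open>c'\<close> rules out the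
      quarter turns, where \<open>a \<noteq> b\<close>.\<close>
    have "flip n a (flip n b x) = x"
      using \<sigma>[OF flip_less flip_less, OF xyn(2,1)] True sc c c' by simp
    then have "a = b" using flip_neq[OF n(1) xyn(1)] by (cases a; cases b) (auto simp: flip_def)
    have two: "two_corners_occupied n f"
      using occ by (simp add: two_corners_occupied_def)
    have ne: "f (x, y) \<noteq> 0" "f (flip n a y, flip n b x) \<noteq> 0" using corners(3,4) c c' by auto
    have "is_2S2 n f"
    proof (cases a)
      case True
      have "f (refl_anti n v) = f v" if "v \<in> grid_nodes n" for v
        using that aut(2) \<sigma> \<open>s\<close> \<open>a = b\<close> True
        by (cases v) (auto simp: grid_nodes_def refl_anti_def flip_def)
      \<comment> \<open>A corner on the mirror axis would be fixed, so the occupied corners lie on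
        the diagonal that crosses it.\<close>
      moreover have "x = y"
        using xy c c' occ(2) \<open>a = b\<close> True N \<open>m \<noteq> N\<close> by (auto simp: flip_def)
      then have "f (mes_c1 n f) \<noteq> 0" "f (mes_c3 n f) \<noteq> 0"
        using ne xy \<open>a = b\<close> True N(4,5) unfolding mes_c1_def mes_c3_def m_def[symmetric] flip_def
        by auto
      ultimately show ?thesis using two unfolding is_2S2_def by blast
    next
      case False
      have "f (refl_main v) = f v" if "v \<in> grid_nodes n" for v
        using that aut(2) \<sigma> \<open>s\<close> \<open>a = b\<close> False
        by (cases v) (auto simp: grid_nodes_def refl_main_def flip_def)
      moreover have "x \<noteq> y"
        using xy c c' occ(2) \<open>a = b\<close> False by (auto simp: flip_def)
      then have "f (mes_c2 n f) \<noteq> 0" "f (mes_c4 n f) \<noteq> 0"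
        using ne xy \<open>a = b\<close> False N(4,5) unfolding mes_c2_def mes_c4_def m_def[symmetric] flip_def
        by auto
      ultimately show ?thesis using two unfolding is_2S2_def by blast
    qed
    then show False using n2 by blast
  qed
qed

section \<open>Invariants of positions and pending moves\<close>

locale two_corner_start =
  fixes n k m :: nat and P0 :: "nat \<Rightarrow> node" and c c' :: node and rc :: nat
  assumes even_n: "even n" and size: "2 * m + 4 \<le> n" and k3: "k \<ge> 3"
    and start_sq: "\<forall>r<k. in_sq n m (P0 r)"
    and c: "c \<in> sq_corners n m" "\<exists>r<k. P0 r = c"
    and c': "c' \<in> sq_corners n m" "rc < k" "P0 rc = c'" and ne: "c \<noteq> c'"
    and start_corners: "\<forall>r<k. P0 r \<in> sq_corners n m \<longrightarrow> P0 r = c \<or> P0 r = c' \<and> r = rc"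
    and not_closer: "\<not> closer n m (conf k P0) c' c"
    and rigid: "\<And>\<sigma>. grid_aut n \<sigma> \<Longrightarrow> \<forall>v \<in> grid_nodes n. conf k P0 (\<sigma> v) = conf k P0 v \<Longrightarrow>
      \<sigma> c' \<noteq> c"
begin

abbreviation "C \<equiv> sq_corners n m"
abbreviation "f0 \<equiv> conf k P0"
abbreviation "good P r w \<equiv> good_step n m f0 c (conf k P) (P r) w"

text \<open>The stage in which neither an empty corner nor a multiplicity identifies the
  target.\<close>

definition paired :: "(nat \<Rightarrow> node) \<Rightarrow> bool" where
  "paired P \<longleftrightarrow> conf k P c = 1 \<and> P rc = c'"

definition nearer :: "(nat \<Rightarrow> node) \<Rightarrow> bool" where
  "nearer P \<longleftrightarrow> (\<exists>i<k. P i \<notin> C \<and> (\<forall>j<k. P j \<notin> C \<longrightarrow> mdist (P i) c < mdist (P j) c'))"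

text \<open>An invariant rather than reachability itself. Only \<open>rc\<close> may stand on
  \<open>c'\<close>, so that a multiplicity can form on no corner but \<open>c\<close>. The
  alternative \<open>conf k P = f0\<close> admits the initial tie.\<close>

definition reachable :: "(nat \<Rightarrow> node) \<Rightarrow> bool" where
  "reachable P \<longleftrightarrow> (\<forall>r<k. in_sq n m (P r)) \<and> (\<exists>r<k. P r = c) \<and>
     (\<forall>r<k. P r \<in> C \<longrightarrow> P r = c \<or> P r = c' \<and> r = rc) \<and>
     (paired P \<longrightarrow> nearer P \<or> conf k P = f0)"

text \<open>The invariant of a pending move. The last conjunct is kept by the moves of other robots,
  however long the move is delayed, and makes the move preserve the last conjunct of reachable.\<close>
definition safe :: "(nat \<Rightarrow> node) \<Rightarrow> nat \<Rightarrow> node \<Rightarrow> bool" where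
  "safe P r w \<longleftrightarrow> P r \<noteq> c \<and> in_sq n m w \<and> mdist w c < mdist (P r) c \<and> (w \<in> C \<longrightarrow> w = c) \<and>
     (paired P \<and> P r \<notin> C \<longrightarrow> mdist w c < mdist w c' \<and>
        (nearer P \<or> (\<forall>j<k. P j \<notin> C \<longrightarrow> mdist w c < mdist (P j) c')))"

lemma n2: "n \<ge> 2" and m2: "2 * m < n"
  using size by auto

lemma corner_grid: "c \<in> grid_nodes n" "c' \<in> grid_nodes n"
  using c c' sq_corners_grid m2 by blast+

lemma reachable_start: "reachable P0"
  unfolding reachable_def using start_sq c start_corners by blast

lemma reachable_grid: "reachable P \<Longrightarrow> \<forall>r<k. P r \<in> grid_nodes n"
  using in_sq_grid unfolding reachable_def by blast

lemma conf_c': "reachable P \<Longrightarrow> b \<in> C \<Longrightarrow> b \<noteq> c \<Longrightarrow> conf k P b \<noteq> 0 \<Longrightarrow>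
    b = c' \<and> P rc = c' \<and> conf k P c' = 1"
  unfolding conf_eq_0_iff conf_eq_1_iff reachable_def using c' ne by metis

lemma conf_c: "reachable P \<Longrightarrow> conf k P c = 1 \<or> conf k P c = 2"
  using conf_values[of k P c] unfolding conf_eq_0_iff reachable_def by blast

lemma closer_nearer: "reachable P \<Longrightarrow> closer n m (conf k P) c c' \<longleftrightarrow> nearer P"
  unfolding nearer_def by (rule closer_conf[OF reachable_grid])

lemma target_c:
  assumes P: "reachable P"
  shows "target n m f0 c (conf k P) c"
proof -
  have "iso_conf n f0 c (conf k P) c" if "conf k P = f0"
    using that grid_aut_id unfolding iso_conf_def by (intro exI[of _ "\<lambda>v. v"]) auto
  then have "conf k P c = 2 \<or> conf k P b = 1 \<and>
      (closer n m (conf k P) c b \<or> iso_conf n f0 c (conf k P) c)"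
    if "b \<in> C" "b \<noteq> c" "conf k P b \<noteq> 0" for b
    using conf_c'[OF P that] conf_c[OF P] P unfolding closer_nearer[OF P, symmetric]
    by (auto simp: reachable_def paired_def closer_nearer[OF P])
  moreover have "conf k P c \<noteq> 0" using conf_c[OF P] by auto
  ultimately show ?thesis using c(1) unfolding target_def by blast
qed

text \<open>A second target could only be \<open>c'\<close>. It cannot win by \<open>closer\<close>,
  by asymmetry or by \<open>not_closer\<close>, so some \<sigma> carries the configuration to
  \<open>f0\<close> and exchanges the corners. Then \<open>closer\<close> in favour of
  \<open>c\<close> would become \<open>closer\<close> in favour of \<open>c'\<close> in
  \<open>f0\<close>, so the configuration is \<open>f0\<close> itself, against
  \<open>rigid\<close>.\<close>

lemma target_unique:
  assumes P: "reachable P" and a: "target n m f0 c (conf k P) a"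
  shows "a = c"
proof (rule ccontr)
  assume "a \<noteq> c"
  with a have ac': "a = c'" "P rc = c'" "conf k P c' = 1"
    using conf_c'[OF P, of a] by (auto simp: target_def)
  have "conf k P c \<noteq> 0" using conf_c[OF P] by auto
  then have h: "conf k P c = 1"
    "closer n m (conf k P) c' c \<or> iso_conf n f0 c (conf k P) c'"
    using a ac' ne c(1) corner_grid unfolding target_def by auto
  then have reach: "closer n m (conf k P) c c' \<or> conf k P = f0"
    using P ac'(2) closer_nearer[OF P] by (auto simp: reachable_def paired_def)
  have "iso_conf n f0 c (conf k P) c'"
    using h(2) reach closer_asym not_closer by metis
  then obtain \<sigma> where \<sigma>: "grid_aut n \<sigma>" "\<forall>v \<in> grid_nodes n. conf k P v = f0 (\<sigma> v)" "\<sigma> c' = c"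
    by (auto simp: iso_conf_def)
  have "\<sigma> c \<in> C" using grid_aut_sq_corners[OF \<sigma>(1) n2 corner_grid(1) m2] c(1) by simp
  moreover have "\<sigma> c \<noteq> c" using \<sigma>(3) ne grid_aut_eq_iff[OF \<sigma>(1) corner_grid] by auto
  moreover have "f0 (\<sigma> c) \<noteq> 0" using \<sigma>(2) corner_grid(1) h(1) by auto
  ultimately have "\<sigma> c = c'" using conf_c'[OF reachable_start] by blast
  then have "\<not> closer n m (conf k P) c c'"
    using closer_aut[OF \<sigma>(1) n2 m2 \<sigma>(2) corner_grid] \<sigma>(3) not_closer by simp
  then have "conf k P = f0" using reach by blast
  then show False using rigid[OF \<sigma>(1)] \<sigma>(2,3) by auto
qed

lemma good_adj: "reachable P \<Longrightarrow> good P r w \<Longrightarrow>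
    mover n m (conf k P) c (P r) \<and> grid_adj (P r) w \<and> mdist w c < mdist (P r) c \<and> in_sq n m w \<and>
    (w \<in> C \<longrightarrow> w = c)"
  unfolding good_step_def using target_unique by blast

text \<open>A look establishes the second alternative in \<open>safe\<close>: the threshold of
  \<open>mover\<close> handles the other robots, and \<open>corner_step_strict\<close> the moving
  robot itself. During a delay \<open>nearer\<close> may take its place.\<close>

lemma good_safe:
  assumes P: "reachable P" and r: "r < k" and w: "good P r w"
  shows "safe P r w"
proof -
  have g: "mover n m (conf k P) c (P r)" "grid_adj (P r) w" "mdist w c < mdist (P r) c"
    "in_sq n m w" "w \<in> C \<longrightarrow> w = c"
    using good_adj[OF P w] by auto
  have "mdist w c < mdist w c' \<and> (\<forall>j<k. P j \<notin> C \<longrightarrow> mdist w c < mdist (P j) c')"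
    if "paired P" "P r \<notin> C"
  proof -
    have "conf k P c' \<noteq> 0" using that(1) c'(2) unfolding paired_def conf_eq_0_iff by blast
    then have far: "\<forall>y \<in> grid_nodes n. y \<notin> C \<and> conf k P y \<noteq> 0 \<longrightarrow> mdist (P r) c \<le> mdist y c'"
      using g(1) that c'(1) ne corner_grid(2) unfolding mover_def paired_def by auto
    have far': "mdist (P r) c \<le> mdist (P j) c'" if "j < k" "P j \<notin> C" for j
      using far that reachable_grid[OF P] unfolding conf_eq_0_iff by blast
    have "mdist w c < mdist w c'"
      using corner_step_strict[OF c(1) c'(1) ne even_n size _ g(4,2,3) far'[OF r that(2)]] P r
      by (simp add: reachable_def)
    then show ?thesis using far' g(3) by (meson order_less_le_trans)
  qed
  then show ?thesis using g by (auto simp: safe_def mover_def)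
qed

context
  fixes P x w
  assumes P: "reachable P" and x: "x < k" and w: "safe P x w"
begin

lemma move_avoids: "w \<noteq> c'" "P x \<noteq> c"
  using w c'(1) ne by (auto simp: safe_def)

text \<open>Safe moves neither leave \<open>c\<close> nor enter \<open>c'\<close>, so a stage once
  left is never entered again. A robot that reaches \<open>c\<close> or leaves \<open>c'\<close>
  ends this stage.\<close>

lemma paired_move_back:
  assumes "paired (P(x := w))"
  shows "paired P" "P x \<notin> C" "w \<notin> C"
proof -
  have p': "P rc = c'" and "x \<noteq> rc"
    using assms move_avoids by (auto simp: paired_def split: if_splits)
  obtain z where z: "z < k" "P z = c" using P by (auto simp: reachable_def)
  have "z \<noteq> x" using z move_avoids by auto
  have "w \<noteq> c"
    using assms z x \<open>z \<noteq> x\<close> unfolding paired_def conf_eq_1_iff by (metis fun_upd_apply)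
  then show "w \<notin> C" using w by (auto simp: safe_def)
  have "{r. r < k \<and> (P(x := w)) r = c} = {r. r < k \<and> P r = c}"
    using \<open>w \<noteq> c\<close> move_avoids by auto
  then have "conf k (P(x := w)) c = conf k P c" by (simp add: conf_def)
  then show "paired P" using assms p' by (simp add: paired_def)
  show "P x \<notin> C" using P x move_avoids \<open>x \<noteq> rc\<close> unfolding reachable_def by blast
qed

text \<open>The new witness is the moved robot if it is now at least as close to \<open>c\<close> as
  the old witness, and the old witness otherwise. The distance from \<open>w\<close> to
  \<open>c'\<close> is covered by the first inequality in \<open>safe\<close>.\<close>

lemma nearer_move:
  assumes "paired (P(x := w))"
  shows "nearer (P(x := w))"
proof -
  let ?P = "P(x := w)"
  note before = paired_move_back[OF assms]
  have s: "mdist w c < mdist w c'" "mdist w c < mdist (P x) c"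
    "nearer P \<or> (\<forall>j<k. P j \<notin> C \<longrightarrow> mdist w c < mdist (P j) c')"
    using w before by (auto simp: safe_def)
  from s(3) show ?thesis
  proof
    assume "\<forall>j<k. P j \<notin> C \<longrightarrow> mdist w c < mdist (P j) c'"
    then show ?thesis using s(1) before x unfolding nearer_def by (intro exI[of _ x]) auto
  next
    assume "nearer P"
    then obtain i where i: "i < k" "P i \<notin> C" "\<forall>j<k. P j \<notin> C \<longrightarrow> mdist (P i) c < mdist (P j) c'"
      by (auto simp: nearer_def)
    show ?thesis
    proof (cases "i = x \<or> mdist w c \<le> mdist (P i) c")
      case True
      then have "mdist w c \<le> mdist (P i) c" using s(2) by auto
      then have "\<forall>j<k. P j \<notin> C \<longrightarrow> mdist w c < mdist (P j) c'"
        using i(3) by (meson order_le_less_trans)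
      then show ?thesis using s(1) before x unfolding nearer_def by (intro exI[of _ x]) auto
    next
      case False
      then show ?thesis using s(1) i unfolding nearer_def by (intro exI[of _ i]) auto
    qed
  qed
qed

lemma reachable_move: "reachable (P(x := w))"
proof -
  have "\<exists>r<k. (P(x := w)) r = c"
    using P move_avoids unfolding reachable_def by (metis fun_upd_apply)
  then show ?thesis
    using P w nearer_move unfolding reachable_def by (auto simp: safe_def)
qed

text \<open>Handles outdated decisions: all but one of the conditions involve only the robot's own
  position and destination, and the remaining one is now supplied by \<open>nearer\<close>.\<close>

lemma safe_move:
  assumes "s \<noteq> x" "safe P s v"
  shows "safe (P(x := w)) s v"
  using assms nearer_move paired_move_back(1) by (auto simp: safe_def)

end

lemma mover_good:
  assumes P: "reachable P" and r: "r < k" and mv: "mover n m (conf k P) c (P r)"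
  shows "\<exists>w. good P r w"
proof -
  have "in_sq n m (P r)" "P r \<noteq> c" using P r mv by (auto simp: reachable_def mover_def)
  then obtain w where "w \<in> grid_nodes n" "grid_adj (P r) w" "mdist w c < mdist (P r) c"
    "in_sq n m w" "w \<in> C \<Longrightarrow> w = c"
    using corner_step[OF c(1) _ _ size] by metis
  then show ?thesis
    using target_c[OF P] mv corner_grid(1) unfolding good_step_def by blast
qed

text \<open>As long as both corners hold single robots, the robot on the other corner and a robot nearest
  to the target may move, so a single crash does not block the progress.\<close>
lemma two_movers:
  assumes P: "reachable P"
  shows "(\<forall>r<k. P r \<noteq> c \<longrightarrow> (\<exists>w. good P r w)) \<or>
    (\<exists>r<k. \<exists>s<k. r \<noteq> s \<and> P r \<noteq> c \<and> P s \<noteq> c \<and> (\<exists>w. good P r w) \<and> (\<exists>w. good P s w))"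
proof (cases "paired P")
  case False
  have "conf k P c = 2 \<or> (\<forall>b \<in> C. b \<noteq> c \<longrightarrow> conf k P b = 0)"
    using conf_c'[OF P] conf_c[OF P] False by (auto simp: paired_def)
  then have "mover n m (conf k P) c (P r)" if "P r \<noteq> c" for r
    using that unfolding mover_def by auto
  then show ?thesis using mover_good[OF P] by blast
next
  case True
  then have "conf k P c = 1" by (simp add: paired_def)
  then obtain rt where rt: "\<And>r. r < k \<Longrightarrow> P r = c \<Longrightarrow> r = rt" unfolding conf_eq_1_iff by metis
  define U where "U = {r. r < k \<and> P r \<notin> C}"
  \<comment> \<open>With three robots, one stands neither on \<open>c\<close> nor on
    \<open>c'\<close>, so there is a robot off the corners.\<close>
  have "\<exists>r<3. r \<noteq> rt \<and> r \<noteq> rc" by presburger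
  then obtain r3 where "r3 < k" "r3 \<noteq> rt" "r3 \<noteq> rc" using k3 order_less_le_trans by blast
  then have "P r3 \<notin> C" using rt P unfolding reachable_def by blast
  then have "r3 \<in> U" using \<open>r3 < k\<close> by (simp add: U_def)
  then obtain r where r: "r \<in> U" "\<forall>s \<in> U. mdist (P r) c \<le> mdist (P s) c"
    using ex_has_least_nat[of "\<lambda>r. r \<in> U" r3 "\<lambda>r. mdist (P r) c"] by auto
  have rU: "r < k" "P r \<notin> C" using r(1) by (auto simp: U_def)
  \<comment> \<open>A robot nearest to \<open>c\<close> meets the threshold of \<open>mover\<close>:
    under \<open>nearer\<close> it is at least as close as the witness, and initially because
    \<open>c'\<close> is not closer.\<close>
  have far: "mdist (P r) c \<le> mdist (P j) c'" if j: "j < k" "P j \<notin> C" for j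
  proof -
    have "nearer P \<or> conf k P = f0" using P True by (simp add: reachable_def)
    then show ?thesis
    proof
      assume "nearer P"
      then obtain i where "i < k" "P i \<notin> C" "mdist (P i) c < mdist (P j) c'"
        using j by (auto simp: nearer_def)
      then show ?thesis using r(2) by (force simp: U_def)
    next
      assume "conf k P = f0"
      then have "\<not> closer n m (conf k P) c' c" using not_closer by simp
      then obtain i where "i < k" "P i \<notin> C" "\<not> mdist (P j) c' < mdist (P i) c"
        using j unfolding closer_conf[OF reachable_grid[OF P]] by blast
      then show ?thesis using r(2) by (force simp: U_def)
    qed
  qed
  have "mover n m (conf k P) c (P r)"
  proof -
    have "P r \<noteq> c" using rU c(1) by auto
    moreover have "mdist (P r) c \<le> mdist y b"
      if "b \<in> C" "b \<noteq> c" "conf k P b \<noteq> 0" "y \<notin> C" "conf k P y \<noteq> 0" for b y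
      using conf_c'[OF P that(1-3)] that(4,5) far unfolding conf_eq_0_iff by auto
    ultimately show ?thesis unfolding mover_def by blast
  qed
  moreover have "P rc = c'" using True by (simp add: paired_def)
  moreover from this have "mover n m (conf k P) c (P rc)"
    using c'(1) ne unfolding mover_def by auto
  moreover have "r \<noteq> rc" using rU c'(1) \<open>P rc = c'\<close> by auto
  moreover have "P r \<noteq> c" "P rc \<noteq> c" using rU c(1) \<open>P rc = c'\<close> ne by auto
  ultimately show ?thesis using mover_good[OF P] rU(1) c'(2) by metis
qed

section \<open>Asynchronous executions\<close>

context
  fixes P :: "nat \<Rightarrow> nat \<Rightarrow> node" and Q :: "nat \<Rightarrow> nat \<Rightarrow> node option" and act :: "nat \<Rightarrow> nat"
  assumes ex: "execution n k (corner_algo n m f0 c) P0 P Q act"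
begin

lemma act_less: "act t < k"
  using ex by (simp add: execution_def Let_def)

lemma step_move:
  "Q t (act t) = Some d \<Longrightarrow> P (Suc t) = (P t)(act t := d) \<and> Q (Suc t) = (Q t)(act t := None)"
  using ex unfolding execution_def Let_def by blast

lemma step_look:
  assumes "Q t (act t) = None" "P t (act t) \<in> grid_nodes n"
  obtains d where "P (Suc t) = P t" "Q (Suc t) = (Q t)(act t := Some d)"
    "good (P t) (act t) d \<or> d = P t (act t) \<and> (\<nexists>w. good (P t) (act t) w)"
proof -
  obtain \<sigma> where \<sigma>: "grid_aut n \<sigma>" "P (Suc t) = P t"
    "Q (Suc t) = (Q t)(act t := Some (\<sigma> (corner_algo n m f0 c (view n \<sigma> (conf k (P t)))
       (inv_into (grid_nodes n) \<sigma> (P t (act t))))))"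
    using ex assms(1) unfolding execution_def Let_def by metis
  show thesis
    using that[OF \<sigma>(2,3)] corner_algo_look[OF \<sigma>(1) n2 m2 assms(2) refl] by blast
qed

text \<open>A pending destination equal to the own node stays so until it is executed, because only
  the robot itself changes its position.\<close>

lemma execution_invariant:
  "reachable (P t) \<and> (\<forall>r<k. \<forall>d. Q t r = Some d \<longrightarrow> d = P t r \<or> safe (P t) r d)"
proof (induction t)
  case 0
  then show ?case using ex reachable_start by (simp add: execution_def)
next
  case (Suc t)
  then have R: "reachable (P t)" and S: "\<forall>r<k. \<forall>d. Q t r = Some d \<longrightarrow> d = P t r \<or> safe (P t) r d"
    by auto
  let ?x = "act t"
  have x: "?x < k" "P t ?x \<in> grid_nodes n" using act_less reachable_grid[OF R] by auto
  show ?case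
  proof (cases "Q t ?x")
    case None
    obtain d where d: "P (Suc t) = P t" "Q (Suc t) = (Q t)(?x := Some d)"
      "good (P t) ?x d \<or> d = P t ?x"
      using step_look[OF None x(2)] by metis
    then show ?thesis using R S good_safe[OF R x(1)] by auto
  next
    case (Some d)
    note st = step_move[OF Some]
    show ?thesis
    proof (cases "d = P t ?x")
      case True
      then have "P (Suc t) = P t" using st by simp
      then show ?thesis using R S st by auto
    next
      case False
      then have d: "safe (P t) ?x d" using S Some x(1) by blast
      have "e = ((P t)(?x := d)) r \<or> safe ((P t)(?x := d)) r e"
        if "r < k" "((Q t)(?x := None)) r = Some e" for r e
        using that S[rule_format, of r e] safe_move[OF R x(1) d, of r e] by (cases "r = ?x") auto
      then show ?thesis
        unfolding conjunct1[OF st] conjunct2[OF st] using reachable_move[OF R x(1) d] by blast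
    qed
  qed
qed

lemmas execution_reachable = execution_invariant[THEN conjunct1]

text \<open>A robot's pending decision changes only at its own steps, so it survives until the first
  activation from \<open>t\<close> on.\<close>

lemma next_activation:
  assumes "infinite {s. act s = x}"
  obtains s where "s \<ge> t" "act s = x" "Q s x = Q t x"
proof -
  obtain s0 where "s0 \<ge> t" "act s0 = x"
    using assms by (auto simp: finite_nat_set_iff_bounded not_less)
  then have ex0: "\<exists>s. s \<ge> t \<and> act s = x" by blast
  define s where "s = (LEAST s. s \<ge> t \<and> act s = x)"
  have s: "s \<ge> t" "act s = x" using LeastI_ex[OF ex0] by (auto simp: s_def)
  have idle: "act i \<noteq> x" if "t \<le> i" "i < s" for i
    using not_less_Least[of i "\<lambda>s. s \<ge> t \<and> act s = x"] that by (auto simp: s_def)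
  have keep: "Q (Suc i) x = Q i x" if "act i \<noteq> x" for i
  proof (cases "Q i (act i)")
    case None
    then show ?thesis
      using that step_look[OF None] act_less reachable_grid[OF execution_reachable]
      by (metis fun_upd_apply)
  next
    case (Some d)
    then show ?thesis using that step_move[OF Some] by simp
  qed
  have "t + j \<le> s \<Longrightarrow> Q (t + j) x = Q t x" for j
    by (induction j) (use keep idle in auto)
  from this[of "s - t"] show thesis using that s by simp
qed

definition potential :: "nat \<Rightarrow> nat" where
  "potential t = (\<Sum>r<k. mdist (P t r) c)"

text \<open>Looks and moves to the own node change no position. Every other executed move is safe
  and lowers one summand.\<close>

lemma potential_step: "P (Suc t) = P t \<or> potential (Suc t) < potential t"
proof (cases "Q t (act t)")
  case None
  then show ?thesis
    using step_look[OF None] act_less reachable_grid[OF execution_reachable] by metis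
next
  case (Some d)
  note st = step_move[OF Some]
  show ?thesis
  proof (cases "d = P t (act t)")
    case True
    then show ?thesis using st by simp
  next
    case False
    then have "safe (P t) (act t) d" using execution_invariant Some act_less by blast
    then have "mdist (P (Suc t) (act t)) c < mdist (P t (act t)) c"
      using st by (simp add: safe_def)
    moreover have "mdist (P (Suc t) r) c \<le> mdist (P t r) c" for r
      using calculation st by (cases "r = act t") auto
    ultimately have "potential (Suc t) < potential t"
      unfolding potential_def using act_less[of t] by (intro sum_strict_mono_ex1) auto
    then show ?thesis by blast
  qed
qed

text \<open>After a time at which the potential is minimal, no step can change a position.\<close>

lemma eventually_constant:
  obtains T where "\<And>t. t \<ge> T \<Longrightarrow> P t = P T"
proof -
  obtain T where T: "\<forall>t. potential T \<le> potential t"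
    using ex_has_least_nat[of "\<lambda>t. True" 0 potential] by auto
  have "P (T + j) = P T" for j
  proof (induction j)
    case (Suc j)
    then have "potential (T + j) = potential T" by (simp add: potential_def)
    then have "P (Suc (T + j)) = P (T + j)" using potential_step[of "T + j"] T by (metis not_le)
    then show ?case using Suc by simp
  qed simp
  then show thesis using that[of T] by (metis le_add_diff_inverse)
qed

text \<open>With positions frozen, a correct robot would look again, decide for a good step and
  finally execute it, which moves it.\<close>

lemma correct_robot_stuck:
  assumes inf: "infinite {s. act s = x}" and T: "\<And>t. t \<ge> T \<Longrightarrow> P t = P T"
  shows "\<not> good (P T) x w"
proof
  assume g: "good (P T) x w"
  obtain s1 where s1: "s1 \<ge> T" "act s1 = x" using next_activation[OF inf] by metis
  \<comment> \<open>An outdated pending move may have to be executed first. The look at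
    \<open>s2\<close> then sees the final positions.\<close>
  obtain s2 where s2: "s2 \<ge> T" "act s2 = x" "Q s2 x = None"
  proof (cases "Q s1 x")
    case None
    then show ?thesis using s1 that by blast
  next
    case (Some d)
    then have "Q (Suc s1) x = None" using step_move s1(2) by auto
    then show ?thesis using next_activation[OF inf, of "Suc s1"] that s1(1)
      by (metis Suc_leD le_trans)
  qed
  have "x < k" using s1 act_less by auto
  then have "P s2 x \<in> grid_nodes n" using reachable_grid[OF execution_reachable] by blast
  \<comment> \<open>Staying is no possible decision, since \<open>g\<close> provides a good
    step.\<close>
  then obtain d where d: "Q (Suc s2) x = Some d" "good (P s2) x d"
    using step_look[of s2] s2 g T[OF s2(1)] by (metis fun_upd_same)
  obtain s3 where s3: "s3 \<ge> Suc s2" "act s3 = x" "Q s3 x = Some d"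
    using next_activation[OF inf, of "Suc s2"] d(1) by metis
  have "P (Suc s3) x = d" using step_move s3 by auto
  moreover have "P (Suc s3) = P s2" using T s2(1) s3(1) by (metis Suc_leD le_SucI le_trans)
  ultimately show False using good_adj[OF execution_reachable d(2)] by auto
qed

text \<open>In the final positions only crashed robots have good steps. With at most one of these,
  the second alternative of \<open>two_movers\<close> fails, and by the first one every robot off
  \<open>c\<close> is crashed.\<close>

lemma execution_gathers:
  assumes "at_most_one_crash k act"
  shows "gathered k P act"
proof -
  obtain T where T: "\<And>t. t \<ge> T \<Longrightarrow> P t = P T" using eventually_constant by blast
  let ?F = "{r. r < k \<and> finite {t. act t = r}}"
  have crashed: "r \<in> ?F" if "r < k" "\<exists>w. good (P T) r w" for r
    using that correct_robot_stuck[OF _ T] by blast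
  have one: "r = s" if "r \<in> ?F" "s \<in> ?F" for r s
    using assms that card_le_Suc0_iff_eq[of ?F] unfolding at_most_one_crash_def by auto
  have "P T r = c" if "r < k" "infinite {s. act s = r}" for r
    using two_movers[OF execution_reachable, of T] crashed one that by blast
  then show ?thesis unfolding gathered_def using T by metis
qed

end

lemma gatherable: "gatherable_one_crash n k P0"
  unfolding gatherable_one_crash_def using valid_corner_algo execution_gathers by blast

end

section \<open>The enclosing square of the initial configuration\<close>

lemma mes_props:
  assumes "n > 0"
  shows "2 * mes n f < n \<and> (\<forall>v \<in> grid_nodes n. f v \<noteq> 0 \<longrightarrow> in_sq n (mes n f) v)"
  unfolding mes_def
proof (rule GreatestI_ex_nat[where b = n])
  show "\<exists>m. 2 * m < n \<and> (\<forall>v \<in> grid_nodes n. f v \<noteq> 0 \<longrightarrow> in_sq n m v)"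
    using assms by (intro exI[of _ 0]) (auto simp: in_sq_def grid_nodes_def)
qed auto

theorem theorem8:
  fixes n k :: nat and P0 :: "nat \<Rightarrow> node"
  assumes "even n"
    and "k \<ge> 3"
    and "\<forall>r < k. P0 r \<in> grid_nodes n"
    and "inj_on P0 {..<k}"
    and "two_corners_occupied n (conf k P0)"
    and "\<not> partitive n (conf k P0)"
    and "\<not> is_2S2 n (conf k P0)"
  shows "gatherable_one_crash n k P0"
proof -
  let ?f = "conf k P0"
  define m where "m = mes n ?f"
  have "P0 0 \<in> grid_nodes n" using assms(2,3) by auto
  then have n: "n > 0" "n \<ge> 2"
    using assms(1) by (auto simp: grid_nodes_def elim!: evenE)
  have occ: "?f v \<noteq> 0 \<longleftrightarrow> (\<exists>r<k. P0 r = v)" for v by (auto simp: conf_eq_0_iff)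
  have m: "2 * m < n" and sq: "\<forall>r<k. in_sq n m (P0 r)"
    using mes_props[OF n(1), of ?f] assms(3) occ unfolding m_def by blast+
  have "card {v \<in> mes_corners n ?f. ?f v \<noteq> 0} = 2"
    using assms(5) by (simp add: two_corners_occupied_def)
  then obtain a b where "{v \<in> mes_corners n ?f. ?f v \<noteq> 0} = {a, b}" "a \<noteq> b"
    by (auto simp: card_2_iff)
  \<comment> \<open>The corners are named so that \<open>c'\<close> does not beat \<open>c\<close>.
    In case of a tie either naming will do.\<close>
  then obtain c c' where cc: "{v \<in> mes_corners n ?f. ?f v \<noteq> 0} = {c, c'}" "c \<noteq> c'"
    and nc: "\<not> closer n m ?f c' c"
    using closer_asym by (metis insert_commute)
  have C: "{v \<in> sq_corners n m. ?f v \<noteq> 0} = {c, c'}"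
    using cc(1) by (simp add: mes_corners_eq m_def)
  \<comment> \<open>Otherwise the square has side two, so all its nodes are corners, and at least
    three robots would stand on two nodes.\<close>
  have size: "2 * m + 4 \<le> n"
  proof (rule ccontr)
    assume "\<not> 2 * m + 4 \<le> n"
    then have nm: "n = 2 * m + 2" using m assms(1) by presburger
    have "P0 r \<in> {c, c'}" if "r < k" for r
    proof -
      have "P0 r \<in> sq_corners n m"
        using sq that nm by (cases "P0 r") (auto simp: in_sq_def sq_corners_def)
      moreover have "?f (P0 r) \<noteq> 0" using occ that by blast
      ultimately show ?thesis using C by blast
    qed
    then have "card (P0 ` {..<k}) \<le> card {c, c'}" by (intro card_mono) auto
    then show False using card_image[OF assms(4)] assms(2) cc(2) by simp
  qed
  obtain rc where rc: "rc < k" "P0 rc = c'" using C occ by blast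
  have "two_corner_start n k m P0 c c' rc"
  proof
    show "\<forall>r<k. P0 r \<in> sq_corners n m \<longrightarrow> P0 r = c \<or> P0 r = c' \<and> r = rc"
      using C occ rc assms(4) by (auto simp: inj_on_def)
    show "\<sigma> c' \<noteq> c" if "grid_aut n \<sigma>" "\<forall>v \<in> grid_nodes n. ?f (\<sigma> v) = ?f v" for \<sigma>
      using no_corner_swap[OF assms(1) n(2) _ cc assms(6,7) that] m by (simp add: m_def)
  qed (use assms(1,2) size sq C occ rc cc(2) nc in blast)+
  then show ?thesis by (rule two_corner_start.gatherable)
qed

end
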